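(* Let $p,q$ be integers with $\min\{p,q\}\ge 2$. If $p\ne q$, then the automorphism group $\operatorname{Aut}(\Pi_{p,q})$ is isomorphic to $\mathbb{Z}_2$; and if $p=q$, then $\operatorname{Aut}(\Pi_{p,q})$ is isomorphic to $\mathbb{Z}_2\times\mathbb{Z}_2$.
   Context: For nonnegative integers $p,q$, the graph $\Pi_{p,q}$ is the simple graph whose vertices are all integer sequences $(\lambda_1,\dots,\lambda_q)$ with $p\ge\lambda_1\ge\cdots\ge\lambda_q\ge 0$ (weak partitions into $q$ parts, parts $0$ allowed, with largest part at most $p$); two vertices are adjacent if one can be obtained from the other by adding $1$ to one of the parts. *)

theory Defs
  imports
    "HOL-Algebra.Bij"
    "HOL-Algebra.Elementary_Groups"
    "Graph_Theory.Pair_Digraph"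
begin

text \<open>
  Undirected simple graphs are represented, as in the \<^theory>\<open>Graph_Theory.Pair_Digraph\<close>
  library, by symmetric loop-free sets of ordered pairs (locale \<^locale>\<open>pair_graph\<close>).
\<close>

definition add_one_to_part :: "nat list \<Rightarrow> nat list \<Rightarrow> bool" where
  "add_one_to_part xs ys \<longleftrightarrow> (\<exists>i < length xs. ys = xs[i := xs ! i + 1])"

definition Pi_graph :: "nat \<Rightarrow> nat \<Rightarrow> nat list pair_pre_digraph" where
  "Pi_graph p q =
    (let V = {xs. length xs = q \<and> sorted_wrt (\<ge>) xs \<and> (\<forall>x \<in> set xs. x \<le> p)} in
      \<lparr> pverts = V,
        parcs = {(xs, ys). xs \<in> V \<and> ys \<in> V \<and> (add_one_to_part xs ys \<or> add_one_to_part ys xs)} \<rparr>)"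

text \<open>
  Automorphisms are taken extensional (arbitrary but fixed value outside the vertex set), as
  in \<^const>\<open>Bij\<close>, so that each one is counted once.
\<close>

definition graph_automorphisms :: "'a pair_pre_digraph \<Rightarrow> ('a \<Rightarrow> 'a) set" where
  "graph_automorphisms G =
    {f \<in> Bij (pverts G).
      \<forall>u \<in> pverts G. \<forall>v \<in> pverts G. (f u, f v) \<in> parcs G \<longleftrightarrow> (u, v) \<in> parcs G}"

definition graph_Aut :: "'a pair_pre_digraph \<Rightarrow> ('a \<Rightarrow> 'a) monoid" where
  "graph_Aut G = BijGroup (pverts G) \<lparr>carrier := graph_automorphisms G\<rparr>"

lemma finite_Pi_verts: "finite (pverts (Pi_graph p q))"
proof (rule finite_subset)
  show "pverts (Pi_graph p q) \<subseteq> {xs. set xs \<subseteq> {..p} \<and> length xs = q}"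
    by (auto simp: Pi_graph_def Let_def)
  show "finite {xs. set xs \<subseteq> {..p} \<and> length xs = q}"
    by (rule finite_lists_length_eq) simp
qed

lemma add_one_to_part_irrefl: "\<not> add_one_to_part xs xs"
proof
  assume "add_one_to_part xs xs"
  then obtain i where "i < length xs" "xs = xs[i := xs ! i + 1]"
    by (auto simp: add_one_to_part_def)
  then have "xs ! i = xs ! i + 1"
    by (metis nth_list_update_eq)
  then show False by simp
qed

lemma pair_graph_Pi_graph: "pair_graph (Pi_graph p q)"
proof unfold_locales
  show "finite (pverts (Pi_graph p q))"
    by (rule finite_Pi_verts)
  have "parcs (Pi_graph p q) \<subseteq> pverts (Pi_graph p q) \<times> pverts (Pi_graph p q)"
    by (auto simp: Pi_graph_def Let_def)
  then show "finite (parcs (Pi_graph p q))"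
    using finite_Pi_verts by (meson finite_SigmaI finite_subset)
  show "symmetric (with_proj (Pi_graph p q))"
    by (auto simp: symmetric_def sym_def Pi_graph_def Let_def)
next
  fix e assume e: "e \<in> parcs (Pi_graph p q)"
  show "fst e \<in> pverts (Pi_graph p q)"
    using e by (cases e) (simp add: Pi_graph_def Let_def)
  show "snd e \<in> pverts (Pi_graph p q)"
    using e by (cases e) (simp add: Pi_graph_def Let_def)
  have "add_one_to_part (fst e) (snd e) \<or> add_one_to_part (snd e) (fst e)"
    using e by (cases e) (simp add: Pi_graph_def Let_def)
  then show "fst e \<noteq> snd e"
    using add_one_to_part_irrefl by metis
qed

lemma subgroup_graph_automorphisms:
  "subgroup (graph_automorphisms G) (BijGroup (pverts G))"
proof (rule subgroup.intro)
  show "graph_automorphisms G \<subseteq> carrier (BijGroup (pverts G))"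
    by (auto simp: graph_automorphisms_def BijGroup_def)
next
  fix f g assume fg: "f \<in> graph_automorphisms G" "g \<in> graph_automorphisms G"
  then have B: "f \<in> Bij (pverts G)" "g \<in> Bij (pverts G)"
    by (simp_all add: graph_automorphisms_def)
  have g: "g u \<in> pverts G" if "u \<in> pverts G" for u
    using Bij_imp_funcset[OF B(2)] that by blast
  show "f \<otimes>\<^bsub>BijGroup (pverts G)\<^esub> g \<in> graph_automorphisms G"
    using fg B g by (simp add: graph_automorphisms_def BijGroup_def compose_Bij compose_eq)
next
  show "\<one>\<^bsub>BijGroup (pverts G)\<^esub> \<in> graph_automorphisms G"
    by (auto simp: graph_automorphisms_def BijGroup_def id_Bij)
next
  fix f assume f: "f \<in> graph_automorphisms G"
  then have B: "f \<in> Bij (pverts G)"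
    by (simp add: graph_automorphisms_def)
  have mem: "inv_into (pverts G) f u \<in> pverts G" and r: "f (inv_into (pverts G) f u) = u"
    if "u \<in> pverts G" for u
    using B that by (auto simp: Bij_def bij_betw_def inv_into_into f_inv_into_f)
  have "(inv_into (pverts G) f u, inv_into (pverts G) f v) \<in> parcs G \<longleftrightarrow> (u, v) \<in> parcs G"
    if "u \<in> pverts G" "v \<in> pverts G" for u v
  proof -
    have "(f (inv_into (pverts G) f u), f (inv_into (pverts G) f v)) \<in> parcs G \<longleftrightarrow>
        (inv_into (pverts G) f u, inv_into (pverts G) f v) \<in> parcs G"
      using f mem[OF that(1)] mem[OF that(2)] by (simp add: graph_automorphisms_def)
    then show ?thesis
      by (simp only: r[OF that(1)] r[OF that(2)])
  qed
  then show "inv\<^bsub>BijGroup (pverts G)\<^esub> f \<in> graph_automorphisms G"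
    using restrict_inv_into_Bij[OF B]
    by (simp add: inv_BijGroup[OF B] graph_automorphisms_def)
qed

lemma group_graph_Aut: "group (graph_Aut G)"
  unfolding graph_Aut_def
  by (rule subgroup.subgroup_is_group[OF subgroup_graph_automorphisms group_BijGroup])

end

theory Submission
  imports Defs "HOL-Library.Product_Order"
begin

text \<open>
  Replacing a partition by its Young diagram turns \<open>Pi_graph p q\<close> into the Hasse diagram of the
  lattice of order ideals of a \<open>q\<close> by \<open>p\<close> rectangle. Its only vertices of degree one are the bottom
  and the top, so after complementation an automorphism fixes the empty diagram; then it preserves
  the number of cells (the distance from the bottom) and hence the covering relation. A diagram with
  two lower covers is their union, and one with a single lower cover is a rectangle, determined by
  that cover once it has more than two cells. So everything is determined by the action on the two
  diagrams with two cells. If these are swapped, composing with transposition gives an isomorphism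
  onto the graph of the transposed rectangle that fixes every diagram, which forces \<open>p = q\<close>.
\<close>

section \<open>Graph isomorphisms and automorphism groups\<close>

text \<open>Source and target may differ: composing an automorphism with transposition lands in the
  graph of the transposed rectangle.\<close>

definition graph_iso :: "('a \<Rightarrow> 'b) \<Rightarrow> 'a pair_pre_digraph \<Rightarrow> 'b pair_pre_digraph \<Rightarrow> bool" where
  "graph_iso f G H \<longleftrightarrow> bij_betw f (pverts G) (pverts H) \<and>
    (\<forall>u \<in> pverts G. \<forall>v \<in> pverts G. (f u, f v) \<in> parcs H \<longleftrightarrow> (u, v) \<in> parcs G)"

lemma graph_iso_in_verts: "graph_iso f G H \<Longrightarrow> u \<in> pverts G \<Longrightarrow> f u \<in> pverts H"
  by (auto simp: graph_iso_def bij_betw_def)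

lemma graph_iso_surj:
  assumes "graph_iso f G H" "v \<in> pverts H"
  obtains u where "u \<in> pverts G" "v = f u"
  using assms unfolding graph_iso_def bij_betw_def by blast

lemma graph_iso_arc_iff:
  "graph_iso f G H \<Longrightarrow> u \<in> pverts G \<Longrightarrow> v \<in> pverts G \<Longrightarrow>
    (f u, f v) \<in> parcs H \<longleftrightarrow> (u, v) \<in> parcs G"
  by (simp add: graph_iso_def)

lemma graph_iso_eq_iff:
  "graph_iso f G H \<Longrightarrow> u \<in> pverts G \<Longrightarrow> v \<in> pverts G \<Longrightarrow> f u = f v \<longleftrightarrow> u = v"
  by (auto simp: graph_iso_def bij_betw_def inj_on_def)

lemma graph_iso_cong:
  assumes "\<And>u. u \<in> pverts G \<Longrightarrow> f u = g u"
  shows "graph_iso f G H \<longleftrightarrow> graph_iso g G H"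
  using assms bij_betw_cong[of "pverts G" f g] by (simp add: graph_iso_def)

lemma graph_iso_comp: "graph_iso f G H \<Longrightarrow> graph_iso g H K \<Longrightarrow> graph_iso (\<lambda>u. g (f u)) G K"
  unfolding graph_iso_def
  using bij_betw_trans[of f "pverts G" "pverts H" g "pverts K"] 
  by (auto simp: comp_def dest: bij_betwE)

lemma graph_iso_inv_into:
  assumes "graph_iso f G H"
  shows "graph_iso (inv_into (pverts G) f) H G"
proof -
  let ?g = "inv_into (pverts G) f"
  have b: "bij_betw f (pverts G) (pverts H)"
    using assms by (simp add: graph_iso_def)
  have g: "?g u \<in> pverts G \<and> f (?g u) = u" if "u \<in> pverts H" for u
    using b that by (auto simp: bij_betw_def inv_into_into f_inv_into_f)
  have "(?g u, ?g v) \<in> parcs G \<longleftrightarrow> (u, v) \<in> parcs H" if "u \<in> pverts H" "v \<in> pverts H" for u v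
    using graph_iso_arc_iff[OF assms, of "?g u" "?g v"] g[OF that(1)] g[OF that(2)] by simp
  then show ?thesis
    using bij_betw_inv_into[OF b] by (simp add: graph_iso_def)
qed

lemma graph_automorphisms_iff:
  "f \<in> graph_automorphisms G \<longleftrightarrow> f \<in> extensional (pverts G) \<and> graph_iso f G G"
  by (auto simp: graph_automorphisms_def Bij_def graph_iso_def)

lemma graph_Aut_mult:
  "f \<in> graph_automorphisms G \<Longrightarrow> g \<in> graph_automorphisms G \<Longrightarrow>
    f \<otimes>\<^bsub>graph_Aut G\<^esub> g = (\<lambda>u \<in> pverts G. f (g u))"
  by (simp add: graph_automorphisms_def graph_Aut_def BijGroup_def compose_def)

lemma graph_Aut_one: "\<one>\<^bsub>graph_Aut G\<^esub> = (\<lambda>u \<in> pverts G. u)"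
  by (simp add: graph_Aut_def BijGroup_def)

lemma graph_Aut_carrier: "carrier (graph_Aut G) = graph_automorphisms G"
  by (simp add: graph_Aut_def)

lemma restrict_in_graph_automorphisms:
  "graph_iso f G G \<Longrightarrow> restrict f (pverts G) \<in> graph_automorphisms G"
  using graph_iso_cong[of G "restrict f (pverts G)" f G] by (simp add: graph_automorphisms_iff)

lemma graph_Aut_cong:
  assumes f: "graph_iso f G H"
  shows "graph_Aut G \<cong> graph_Aut H"
proof -
  define g where "g = inv_into (pverts G) f"
  have g: "graph_iso g H G"
    unfolding g_def by (rule graph_iso_inv_into[OF f])
  have b: "bij_betw f (pverts G) (pverts H)"
    using f by (simp add: graph_iso_def)
  have fg: "f (g u) = u" if "u \<in> pverts H" for u
    using b that by (simp add: g_def bij_betw_def f_inv_into_f)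
  have gf: "g (f u) = u" if "u \<in> pverts G" for u
    using b that by (simp add: g_def bij_betw_def)
  note fin = graph_iso_in_verts[OF f] and gin = graph_iso_in_verts[OF g]
  \<comment> \<open>Conjugation by \<open>f\<close>, with conjugation by its inverse
    \<open>g\<close> as \<open>\<psi>\<close>; both are cut down to the vertex set to stay
    extensional.\<close>
  define \<phi> where "\<phi> h = (\<lambda>u \<in> pverts H. f (h (g u)))" for h
  define \<psi> where "\<psi> k = (\<lambda>u \<in> pverts G. g (k (f u)))" for k
  have \<phi>: "\<phi> h \<in> graph_automorphisms H" if "h \<in> graph_automorphisms G" for h
    unfolding \<phi>_def using that graph_iso_comp[OF graph_iso_comp[OF g] f]
    by (intro restrict_in_graph_automorphisms) (simp add: graph_automorphisms_iff)
  have \<psi>: "\<psi> k \<in> graph_automorphisms G" if "k \<in> graph_automorphisms H" for k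
    unfolding \<psi>_def using that graph_iso_comp[OF graph_iso_comp[OF f] g]
    by (intro restrict_in_graph_automorphisms) (simp add: graph_automorphisms_iff)
  have in_verts: "h u \<in> pverts K" if "h \<in> graph_automorphisms K" "u \<in> pverts K"
    for h :: "'c \<Rightarrow> 'c" and K u
    using that graph_iso_in_verts by (auto simp: graph_automorphisms_iff)
  have "\<psi> (\<phi> h) = h" if "h \<in> graph_automorphisms G" for h
  proof (rule extensionalityI[of _ "pverts G"])
    show "h \<in> extensional (pverts G)"
      using that by (simp add: graph_automorphisms_iff)
  qed (use that in \<open>auto simp: \<psi>_def \<phi>_def fin gf in_verts\<close>)
  moreover have "\<phi> (\<psi> k) = k" if "k \<in> graph_automorphisms H" for k
  proof (rule extensionalityI[of _ "pverts H"])
    show "k \<in> extensional (pverts H)"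
      using that by (simp add: graph_automorphisms_iff)
  qed (use that in \<open>auto simp: \<psi>_def \<phi>_def gin fg in_verts\<close>)
  ultimately have "bij_betw \<phi> (graph_automorphisms G) (graph_automorphisms H)"
    using \<phi> \<psi> by (intro bij_betwI[where g = \<psi>]) auto
  moreover have "\<phi> (h \<otimes>\<^bsub>graph_Aut G\<^esub> k) = \<phi> h \<otimes>\<^bsub>graph_Aut H\<^esub> \<phi> k"
    if "h \<in> graph_automorphisms G" "k \<in> graph_automorphisms G" for h k
    using that \<phi> by (auto simp: graph_Aut_mult \<phi>_def gin gf in_verts fin intro!: restrict_ext)
  ultimately have "\<phi> \<in> iso (graph_Aut G) (graph_Aut H)"
    using \<phi> by (intro isoI homI) (simp_all add: graph_Aut_carrier)
  then show ?thesis
    by (rule is_isoI)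
qed

section \<open>Groups of order two and four\<close>

lemma (in group) is_iso_two_elements:
  assumes "carrier G = {\<one>, a}" "a \<noteq> \<one>"
  shows "G \<cong> integer_mod_group 2"
proof -
  have "a \<in> carrier G"
    using assms(1) by simp
  \<comment> \<open>By cancellation, since \<open>a\<close> is not the unit; only the unit is left
    as a value.\<close>
  then have "a \<otimes> a \<noteq> a"
    using assms(2) by simp
  then have aa: "a \<otimes> a = \<one>"
    using assms(1) m_closed[OF \<open>a \<in> carrier G\<close> \<open>a \<in> carrier G\<close>] by auto
  define \<phi> where "\<phi> x = (if x = \<one> then 0 else 1 :: int)" for x
  have "{0..<2} = {0, 1 :: int}"
    by auto
  then have "\<phi> \<in> iso G (integer_mod_group 2)"
    using assms aa \<open>a \<in> carrier G\<close>
    by (intro isoI homI)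
      (auto simp: \<phi>_def carrier_integer_mod_group mult_integer_mod_group bij_betw_def)
  then show ?thesis
    by (rule is_isoI)
qed

lemma (in group) is_iso_Klein_four:
  assumes carrier: "carrier G = {\<one>, a, b, a \<otimes> b}"
    and sq: "a \<otimes> a = \<one>" "b \<otimes> b = \<one>"
    and ne: "a \<noteq> \<one>" "b \<noteq> \<one>" "a \<noteq> b"
  shows "G \<cong> integer_mod_group 2 \<times>\<times> integer_mod_group 2"
proof -
  have ab: "a \<in> carrier G" "b \<in> carrier G"
    unfolding carrier by blast+
  have "inv a = a" "inv b = b"
    using inv_equality[OF sq(1)] inv_equality[OF sq(2)] ab by simp_all
  \<comment> \<open>Both generators are their own inverses, so a product equal to the unit would
    make them equal.\<close>
  then have ab_ne: "a \<otimes> b \<noteq> \<one>" and ba_ne: "b \<otimes> a \<noteq> \<one>"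
    using ab ne(3) inv_equality by metis+
  have ab_ne': "a \<otimes> b \<noteq> a" "a \<otimes> b \<noteq> b" and ba_ne': "b \<otimes> a \<noteq> a" "b \<otimes> a \<noteq> b"
    using ab ne(1,2) by simp_all
  \<comment> \<open>Commutativity is by elimination: of the four elements only
    \<open>a \<otimes> b\<close> remains.\<close>
  have ba: "b \<otimes> a = a \<otimes> b"
    using m_closed[OF ab(2,1)] ba_ne ba_ne' unfolding carrier by blast
  have a_ab: "a \<otimes> (a \<otimes> b) = b"
    using ab sq by (simp add: m_assoc[symmetric])
  have b_ab: "b \<otimes> (a \<otimes> b) = a"
    using ab sq ba by (metis m_assoc l_one)
  have ab_x: "a \<otimes> b \<otimes> a = b" "a \<otimes> b \<otimes> b = a" "a \<otimes> b \<otimes> (a \<otimes> b) = \<one>"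
    using ab sq a_ab b_ab ba by (simp_all add: m_assoc)
  \<comment> \<open>The coordinates are the exponents of \<open>a\<close> and of
    \<open>b\<close>.\<close>
  define \<phi> where "\<phi> x = (if x = a \<or> x = a \<otimes> b then 1 else 0 :: int,
    if x = b \<or> x = a \<otimes> b then 1 else 0 :: int)" for x
  have \<phi>: "\<phi> \<one> = (0, 0)" "\<phi> a = (1, 0)" "\<phi> b = (0, 1)" "\<phi> (a \<otimes> b) = (1, 1)"
    using ne ab_ne ab_ne' by (auto simp: \<phi>_def)
  have "{0..<2} = {0, 1 :: int}"
    by auto
  moreover have "bij_betw \<phi> (carrier G) ({0, 1} \<times> {0, 1})"
    unfolding carrier bij_betw_def by (auto simp: \<phi> inj_on_def)
  moreover have "\<phi> (x \<otimes> y) = \<phi> x \<otimes>\<^bsub>integer_mod_group 2 \<times>\<times> integer_mod_group 2\<^esub> \<phi> y"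
    if "x \<in> carrier G" "y \<in> carrier G" for x y
    using that unfolding carrier
    by (elim insertE emptyE) (simp_all add: \<phi> ab sq ba a_ab b_ab ab_x)
  ultimately have "\<phi> \<in> iso G (integer_mod_group 2 \<times>\<times> integer_mod_group 2)"
    by (intro isoI homI) (auto simp: carrier_integer_mod_group bij_betw_def)
  then show ?thesis
    by (rule is_isoI)
qed

section \<open>Order ideals of a rectangle\<close>

definition box :: "nat \<Rightarrow> nat \<Rightarrow> (nat \<times> nat) set" where
  "box m n = {..<m} \<times> {..<n}"

text \<open>The order on cells is the componentwise one of \<open>Product_Order\<close>, so these
  are the order ideals of a product of two chains.\<close>

definition diagrams :: "nat \<Rightarrow> nat \<Rightarrow> (nat \<times> nat) set set" where
  "diagrams m n = {D. D \<subseteq> box m n \<and> (\<forall>x \<in> D. \<forall>y \<le> x. y \<in> D)}"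

text \<open>Stated through cardinality, since isomorphisms will be controlled through the number of
  cells; \<open>covers_iff_insert\<close> gives the form with one added cell.\<close>

definition covers :: "'a set \<Rightarrow> 'a set \<Rightarrow> bool" where
  "covers E D \<longleftrightarrow> D \<subseteq> E \<and> card E = Suc (card D)"

definition diagram_graph :: "nat \<Rightarrow> nat \<Rightarrow> (nat \<times> nat) set pair_pre_digraph" where
  "diagram_graph m n =
    \<lparr> pverts = diagrams m n,
      parcs = {(D, E). D \<in> diagrams m n \<and> E \<in> diagrams m n \<and> (covers D E \<or> covers E D)} \<rparr>"

lemma pverts_diagram_graph [simp]: "pverts (diagram_graph m n) = diagrams m n"
  by (simp add: diagram_graph_def)

lemma parcs_diagram_graph_iff:
  "(D, E) \<in> parcs (diagram_graph m n) \<longleftrightarrow>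
    D \<in> diagrams m n \<and> E \<in> diagrams m n \<and> (covers D E \<or> covers E D)"
  by (simp add: diagram_graph_def)

lemma covers_iff_insert:
  assumes "finite E"
  shows "covers E D \<longleftrightarrow> (\<exists>x. x \<notin> D \<and> E = insert x D)"
proof
  assume "covers E D"
  then have "D \<subseteq> E" "card (E - D) = 1"
    using card_Diff_subset[of D E] finite_subset[OF _ assms] by (auto simp: covers_def)
  then show "\<exists>x. x \<notin> D \<and> E = insert x D"
    by (metis Diff_iff Diff_partition Un_insert_right card_1_singletonE insertI1 sup_bot_right)
next
  assume "\<exists>x. x \<notin> D \<and> E = insert x D"
  then show "covers E D"
    using assms by (auto simp: covers_def)
qed

lemma finite_box: "finite (box m n)"
  by (simp add: box_def)

lemma finite_diagram: "D \<in> diagrams m n \<Longrightarrow> finite D"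
  using finite_subset[OF _ finite_box] by (auto simp: diagrams_def)

lemma diagram_down: "D \<in> diagrams m n \<Longrightarrow> x \<in> D \<Longrightarrow> y \<le> x \<Longrightarrow> y \<in> D"
  unfolding diagrams_def by blast

lemma empty_in_diagrams: "{} \<in> diagrams m n"
  by (simp add: diagrams_def)

lemma box_in_diagrams: "box m n \<in> diagrams m n"
  by (auto simp: diagrams_def box_def)

text \<open>A maximal cell can be removed without destroying the ideal. Choosing it above a
  prescribed \<open>z\<close> is what later bounds every cell by the top of a rectangle.\<close>

lemma diagram_remove_corner:
  assumes D: "D \<in> diagrams m n" and z: "z \<in> D"
  obtains w where "w \<in> D" "z \<le> w" "D - {w} \<in> diagrams m n"
proof -
  obtain w where w: "w \<in> D" "z \<le> w" "\<forall>y \<in> D. w \<le> y \<longrightarrow> w = y"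
    using finite_has_maximal2[OF finite_diagram[OF D] z] by auto
  moreover have "D - {w} \<in> diagrams m n"
    using D w by (auto simp: diagrams_def)
  ultimately show ?thesis
    using that by blast
qed

lemma diagram_add_corner:
  assumes D: "D \<in> diagrams m n" and "D \<noteq> box m n"
  obtains w where "w \<notin> D" "insert w D \<in> diagrams m n"
proof -
  have "box m n - D \<noteq> {}"
    using assms by (auto simp: diagrams_def)
  then obtain w where w: "w \<in> box m n - D" "\<forall>y \<in> box m n - D. y \<le> w \<longrightarrow> w = y"
    using finite_has_minimal[of "box m n - D"] finite_box by auto
  \<comment> \<open>The box is itself an ideal, so a cell below \<open>w\<close> that is not in
    \<open>D\<close> lies in the set where \<open>w\<close> is minimal.\<close>
  have "y \<in> insert w D" if "y \<le> w" for y
  proof -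
    have "y \<in> box m n"
      using that w(1) by (cases y; cases w) (auto simp: box_def)
    then show ?thesis
      using w(2) that by auto
  qed
  then have "insert w D \<in> diagrams m n"
    using D w(1) by (auto simp: diagrams_def)
  then show ?thesis
    using that w(1) by blast
qed

lemma covers_remove: "finite D \<Longrightarrow> w \<in> D \<Longrightarrow> covers D (D - {w})"
  by (auto simp: covers_iff_insert)

lemma zero_in_diagram:
  assumes "D \<in> diagrams m n" "D \<noteq> {}"
  shows "(0, 0) \<in> D"
proof -
  obtain i j where "(i, j) \<in> D"
    using assms(2) by auto
  then show ?thesis
    using diagram_down[OF assms(1), of "(i, j)" "(0, 0)"] by simp
qed

lemma diagram_card_1:
  assumes "D \<in> diagrams m n" "card D = 1"
  shows "D = {(0, 0)}"
  using assms zero_in_diagram[of D m n] by (auto simp: card_1_singleton_iff)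

lemma diagram_card_2:
  assumes "D \<in> diagrams m n" "card D = 2"
  shows "D = {(0, 0), (0, 1)} \<or> D = {(0, 0), (1, 0)}"
proof -
  have "(0, 0) \<in> D"
    using assms zero_in_diagram[of D m n] by (cases "D = {}") auto
  then obtain i j where D: "D = {(0, 0), (i, j)}" "(i, j) \<noteq> (0, 0)"
    using assms(2) by (auto simp: card_2_iff)
  \<comment> \<open>Each of these cells must be one of the two in \<open>D\<close>. Subtraction is
    truncated, so for a zero coordinate the cell is \<open>(i, j)\<close> itself and says
    nothing.\<close>
  have "(i - 1, j) \<in> D" "(i, j - 1) \<in> D"
    using diagram_down[OF assms(1), of "(i, j)" "(i - 1, j)"]
      diagram_down[OF assms(1), of "(i, j)" "(i, j - 1)"] D by auto
  with D show ?thesis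
    by auto
qed

section \<open>Isomorphisms of diagram graphs\<close>

text \<open>Emptying \<open>D\<close> cell by cell is a path of length \<open>card D\<close> to the
  empty diagram, and each edge of the image path changes the number of cells by one.\<close>

lemma diagram_iso_card_le:
  assumes f: "graph_iso f (diagram_graph m n) (diagram_graph m' n')" "f {} = {}"
  shows "D \<in> diagrams m n \<Longrightarrow> card (f D) \<le> card D"
proof (induction "card D" arbitrary: D)
  case 0
  then show ?case
    using f(2) finite_diagram by fastforce
next
  case (Suc k)
  then have "D \<noteq> {}"
    by auto
  then obtain w where w: "w \<in> D" "D - {w} \<in> diagrams m n"
    using diagram_remove_corner[OF Suc.prems] by blast
  have "(D - {w}, D) \<in> parcs (diagram_graph m n)"
    using w Suc.prems covers_remove[OF finite_diagram[OF Suc.prems] w(1)]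
    by (simp add: parcs_diagram_graph_iff)
  then have "(f (D - {w}), f D) \<in> parcs (diagram_graph m' n')"
    using graph_iso_arc_iff[OF f(1), of "D - {w}" D] w Suc.prems by simp
  then have "card (f D) \<le> Suc (card (f (D - {w})))"
    by (auto simp: parcs_diagram_graph_iff covers_def)
  moreover have "card D = Suc (card (D - {w}))"
    using covers_remove[OF finite_diagram[OF Suc.prems] w(1)] by (simp add: covers_def)
  ultimately show ?case
    using Suc.hyps(1)[of "D - {w}"] Suc.hyps(2) w(2) by simp
qed

text \<open>The missing inequality is the previous one for the inverse isomorphism.\<close>

lemma diagram_iso_card:
  assumes f: "graph_iso f (diagram_graph m n) (diagram_graph m' n')" "f {} = {}"
    and D: "D \<in> diagrams m n"
  shows "card (f D) = card D"
proof (rule antisym)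
  let ?g = "inv_into (diagrams m n) f"
  have inj: "inj_on f (diagrams m n)"
    using f(1) by (simp add: graph_iso_def bij_betw_def)
  have "?g {} = {}"
    using inv_into_f_f[OF inj empty_in_diagrams] f(2) by simp
  moreover have "graph_iso ?g (diagram_graph m' n') (diagram_graph m n)"
    using graph_iso_inv_into[OF f(1)] by simp
  moreover have "f D \<in> diagrams m' n'"
    using graph_iso_in_verts[OF f(1)] D by simp
  ultimately have "card (?g (f D)) \<le> card (f D)"
    using diagram_iso_card_le by blast
  then show "card D \<le> card (f D)"
    using inv_into_f_f[OF inj D] by simp
qed (rule diagram_iso_card_le[OF f D])

text \<open>An edge is directed by the sizes of its ends, and \<open>f\<close> preserves both edges
  and sizes.\<close>

lemma diagram_iso_covers:
  assumes f: "graph_iso f (diagram_graph m n) (diagram_graph m' n')" "f {} = {}"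
    and DE: "D \<in> diagrams m n" "E \<in> diagrams m n"
  shows "covers (f D) (f E) \<longleftrightarrow> covers D E"
proof -
  have "f D \<in> diagrams m' n'" "f E \<in> diagrams m' n'"
    using graph_iso_in_verts[OF f(1)] DE by simp_all
  then have "covers (f D) (f E) \<or> covers (f E) (f D) \<longleftrightarrow> covers D E \<or> covers E D"
    using graph_iso_arc_iff[OF f(1), of D E] DE by (simp add: parcs_diagram_graph_iff)
  moreover have "covers A B \<Longrightarrow> card B < card A" for A B :: "(nat \<times> nat) set"
    by (simp add: covers_def)
  ultimately show ?thesis
    using diagram_iso_card[OF f DE(1)] diagram_iso_card[OF f DE(2)] by (metis less_asym)
qed

text \<open>Above any cell lies a removable one, and uniqueness forces that one to be
  \<open>x\<close>.\<close>

lemma unique_lower_cover_imp_principal: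
  assumes D: "D \<in> diagrams m n" and x: "x \<in> D"
    and unique: "\<And>E. E \<in> diagrams m n \<Longrightarrow> covers D E \<Longrightarrow> E = D - {x}"
  shows "D = {..x}"
proof -
  have "z \<le> x" if z: "z \<in> D" for z
  proof -
    obtain w where w: "w \<in> D" "z \<le> w" "D - {w} \<in> diagrams m n"
      using diagram_remove_corner[OF D z] .
    then have "D - {w} = D - {x}"
      using unique covers_remove[OF finite_diagram[OF D]] by blast
    then have "w = x"
      using w(1) x by blast
    then show ?thesis
      using w(2) by simp
  qed
  then show ?thesis
    using diagram_down[OF D x] by auto
qed

text \<open>
  Two distinct principal ideals that become equal after removing their tops are the row and the
  column of two cells.
\<close>

lemma principal_ideal_remove_top_inj:
  fixes x y :: "nat \<times> nat"
  assumes eq: "{..x} - {x} = {..y} - {y}" and card: "2 < card {..x}"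
  shows "x = y"
proof (rule ccontr)
  assume ne: "x \<noteq> y"
  obtain a b c d where x: "x = (a, b)" and y: "y = (c, d)"
    by fastforce
  have ideal: "z \<le> x \<and> z \<noteq> x \<longleftrightarrow> z \<le> y \<and> z \<noteq> y" for z
    using eq by (metis Diff_iff atMost_iff singletonD singletonI)
  \<comment> \<open>If one were below the other, it would lie strictly below itself by
    \<open>ideal\<close>. Hence the two cells are incomparable.\<close>
  have "\<not> x \<le> y" "\<not> y \<le> x"
    using ideal[of x] ideal[of y] ne by auto
  then consider "a < c" "d < b" | "c < a" "b < d"
    using x y by fastforce
  then show False
  proof cases
    case 1
    \<comment> \<open>For \<open>d > 0\<close> the cell \<open>(c, 0)\<close> is strictly below
      \<open>y\<close> but not below \<open>x\<close>, as \<open>a < c\<close>; likewise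
      \<open>(0, b)\<close> for \<open>a > 0\<close>.\<close>
    then have "d = 0" "a = 0"
      using ideal[of "(c, 0)"] ideal[of "(0, b)"] x y by auto
    \<comment> \<open>Otherwise \<open>(0, 1)\<close> is strictly below \<open>x\<close> but not
      below \<open>y = (c, 0)\<close>. So the ideal of \<open>x\<close> has at most two
      cells.\<close>
    moreover have "b \<le> 1"
      using ideal[of "(0, 1)"] x y 1 \<open>d = 0\<close> by auto
    moreover have "{..x} \<subseteq> {0..a} \<times> {0..b}"
      using x by auto
    then have "card {..x} \<le> Suc a * Suc b"
      using card_mono[of "{0..a} \<times> {0..b}" "{..x}"] by (simp add: card_cartesian_product)
    ultimately show False
      using card by auto
  next
    case 2
    then have "c = 0" "b = 0"
      using ideal[of "(0, d)"] ideal[of "(a, 0)"] x y by auto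
    moreover have "a \<le> 1"
      using ideal[of "(1, 0)"] x y 2 \<open>c = 0\<close> by auto
    moreover have "{..x} \<subseteq> {0..a} \<times> {0..b}"
      using x by auto
    then have "card {..x} \<le> Suc a * Suc b"
      using card_mono[of "{0..a} \<times> {0..b}" "{..x}"] by (simp add: card_cartesian_product)
    ultimately show False
      using card by auto
  qed
qed

text \<open>By induction the lower covers of \<open>D\<close> are fixed, so they are lower covers of
  \<open>f D\<close> too. The target rectangle is left free so that the lemma applies after a
  transposition.\<close>

lemma diagram_iso_fixes_all:
  assumes f: "graph_iso f (diagram_graph m n) (diagram_graph m' n')" "f {} = {}"
    and two: "\<And>D. D \<in> diagrams m n \<Longrightarrow> card D = 2 \<Longrightarrow> f D = D"
  shows "D \<in> diagrams m n \<Longrightarrow> f D = D"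
proof (induction "card D" arbitrary: D rule: less_induct)
  case less
  note D = less.prems
  have f_in: "f E \<in> diagrams m' n'" if "E \<in> diagrams m n" for E
    using graph_iso_in_verts[OF f(1)] that by simp
  have fD: "f D \<in> diagrams m' n'" "card (f D) = card D"
    using f_in diagram_iso_card[OF f] D by simp_all
  have fixed: "f E = E" if "E \<in> diagrams m n" "covers D E" for E
    using less.hyps[of E] that by (simp add: covers_def)
  have up: "covers (f D) E" if "E \<in> diagrams m n" "covers D E" for E
    using diagram_iso_covers[OF f D that(1)] fixed that by simp
  consider "card D = 0" | "card D = 1" | "card D = 2" | "2 < card D"
    by linarith
  then show ?case
  proof cases
    case 1
    then show ?thesis
      using f(2) finite_diagram[OF D] by simp
  next
    case 2
    then show ?thesis
      using diagram_card_1[OF D] diagram_card_1[OF fD(1)] fD(2) by simp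
  next
    case 3
    then show ?thesis
      by (rule two[OF D])
  next
    case 4
    then have "D \<noteq> {}"
      by auto
    then obtain x where x: "x \<in> D" "D - {x} \<in> diagrams m n"
      using diagram_remove_corner[OF D] by blast
    have cov_x: "covers D (D - {x})"
      using covers_remove[OF finite_diagram[OF D] x(1)] .
    show ?thesis
    proof (cases "\<forall>E \<in> diagrams m n. covers D E \<longrightarrow> E = D - {x}")
      case False
      then obtain E where E: "E \<in> diagrams m n" "covers D E" "E \<noteq> D - {x}"
        by blast
      have "E \<subseteq> D" "card E = card (D - {x})"
        using E(2) cov_x by (auto simp: covers_def)
      \<comment> \<open>Two different subsets of \<open>D\<close> each missing one cell have union
        \<open>D\<close>, and both lie in \<open>f D\<close>.\<close>
      then have "x \<in> E"
        using E(3) card_subset_eq[of "D - {x}" E] finite_diagram[OF D] by blast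
      then have "D \<subseteq> f D"
        using up[OF E(1,2)] up[OF x(2) cov_x] by (auto simp: covers_def)
      then show ?thesis
        using card_subset_eq[OF finite_diagram[OF fD(1)]] fD(2) by metis
    next
      case True
      then have D_eq: "D = {..x}"
        using unique_lower_cover_imp_principal[OF D x(1)] by blast
      obtain y where y: "y \<notin> D - {x}" "f D = insert y (D - {x})"
        using up[OF x(2) cov_x] covers_iff_insert[OF finite_diagram[OF fD(1)]] by blast
      \<comment> \<open>Lower covers of \<open>f D\<close> come from lower covers of
        \<open>D\<close>. There is only one, so \<open>f D\<close> is principal as well.\<close>
      have "E = f D - {y}" if E: "E \<in> diagrams m' n'" "covers (f D) E" for E
      proof -
        obtain E' where E': "E' \<in> diagrams m n" "E = f E'"
          using graph_iso_surj[OF f(1)] E(1) by auto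
        then have "covers D E'"
          using diagram_iso_covers[OF f D E'(1)] E(2) by simp
        then show ?thesis
          using True E' fixed y by auto
      qed
      then have fD_eq: "f D = {..y}"
        using unique_lower_cover_imp_principal[OF fD(1), of y] y(2) by blast
      have "{..x} - {x} = {..y} - {y}"
        using y D_eq fD_eq by auto
      then have "x = y"
        using 4 D_eq by (intro principal_ideal_remove_top_inj) simp_all
      then show ?thesis
        using D_eq fD_eq by simp
    qed
  qed
qed

text \<open>Otherwise \<open>f {}\<close> has a lower and an upper cover. Their preimages are both
  neighbours of the empty diagram, whose only possible neighbour is the single cell.\<close>

lemma diagram_iso_empty:
  assumes f: "graph_iso f (diagram_graph m n) (diagram_graph m' n')"
  shows "f {} = {} \<or> f {} = box m' n'"
proof (rule ccontr)
  let ?D = "f {}"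
  assume "\<not> (f {} = {} \<or> f {} = box m' n')"
  then have ne: "?D \<noteq> {}" "?D \<noteq> box m' n'"
    by auto
  have D: "?D \<in> diagrams m' n'"
    using graph_iso_in_verts[OF f] empty_in_diagrams by simp
  obtain w where w: "w \<in> ?D" "?D - {w} \<in> diagrams m' n'"
    using diagram_remove_corner[OF D] ne(1) by blast
  obtain v where v: "v \<notin> ?D" "insert v ?D \<in> diagrams m' n'"
    using diagram_add_corner[OF D ne(2)] .
  obtain E where E: "E \<in> diagrams m n" "?D - {w} = f E"
    using graph_iso_surj[OF f] w(2) by auto
  obtain E' where E': "E' \<in> diagrams m n" "insert v ?D = f E'"
    using graph_iso_surj[OF f] v(2) by auto
  have "covers ?D (?D - {w})" "covers (insert v ?D) ?D"
    using covers_remove[OF finite_diagram[OF D] w(1)] covers_iff_insert[OF finite_diagram[OF v(2)]] v(1)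
    by blast+
  then have "(?D, f E) \<in> parcs (diagram_graph m' n')" "(?D, f E') \<in> parcs (diagram_graph m' n')"
    unfolding E(2)[symmetric] E'(2)[symmetric] parcs_diagram_graph_iff using D w(2) v(2) by blast+
  then have "({}, E) \<in> parcs (diagram_graph m n)" "({}, E') \<in> parcs (diagram_graph m n)"
    using graph_iso_arc_iff[OF f, of "{}" E] graph_iso_arc_iff[OF f, of "{}" E']
      E(1) E'(1) empty_in_diagrams by simp_all
  then have "E = {(0, 0)}" "E' = {(0, 0)}"
    using diagram_card_1 by (auto simp: parcs_diagram_graph_iff covers_def)
  then have "?D - {w} = insert v ?D"
    using E(2) E'(2) by metis
  then show False
    using v(1) by blast
qed

section \<open>Transposition and complementation\<close>

text \<open>The set complement in the rectangle is an up-set; the half turn of the rectangle makes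
  it an ideal again.\<close>

definition complement :: "nat \<Rightarrow> nat \<Rightarrow> (nat \<times> nat) set \<Rightarrow> (nat \<times> nat) set" where
  "complement m n D = {(i, j) \<in> box m n. (m - 1 - i, n - 1 - j) \<notin> D}"

lemma swap_in_diagrams: "D \<in> diagrams m n \<Longrightarrow> prod.swap ` D \<in> diagrams n m"
  by (force simp: diagrams_def box_def)

lemma covers_image: "inj h \<Longrightarrow> covers (h ` E) (h ` D) \<longleftrightarrow> covers E D"
  by (simp add: covers_def inj_image_subset_iff card_image inj_on_subset[OF _ subset_UNIV])

lemma swap_iso: "graph_iso ((`) prod.swap) (diagram_graph m n) (diagram_graph n m)"
proof -
  have "bij_betw ((`) prod.swap) (diagrams m n) (diagrams n m)"
    by (rule bij_betwI[where g = "(`) prod.swap"]) (auto simp: swap_in_diagrams image_comp)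
  then show ?thesis
    by (simp add: graph_iso_def parcs_diagram_graph_iff swap_in_diagrams covers_image)
qed

lemma complement_in_diagrams:
  assumes D: "D \<in> diagrams m n"
  shows "complement m n D \<in> diagrams m n"
proof -
  have "(k, l) \<in> complement m n D" if "(i, j) \<in> complement m n D" "k \<le> i" "l \<le> j" for i j k l
    using diagram_down[OF D, of "(m - 1 - k, n - 1 - l)" "(m - 1 - i, n - 1 - j)"] that
    by (auto simp: complement_def box_def diff_le_mono2)
  then have "y \<in> complement m n D" if "x \<in> complement m n D" "y \<le> x" for x y
    using that by (cases x; cases y) simp
  moreover have "complement m n D \<subseteq> box m n"
    by (auto simp: complement_def)
  ultimately show ?thesis
    unfolding diagrams_def by blast
qed

lemma complement_complement: "D \<in> diagrams m n \<Longrightarrow> complement m n (complement m n D) = D"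
  by (auto simp: complement_def diagrams_def box_def)

lemma complement_empty: "complement m n {} = box m n"
  by (simp add: complement_def)

lemma complement_covers:
  assumes "D \<in> diagrams m n" "E \<in> diagrams m n" "covers E D"
  shows "covers (complement m n D) (complement m n E)"
proof -
  obtain i j where ij: "(i, j) \<notin> D" "E = insert (i, j) D"
    using assms(3) covers_iff_insert[OF finite_diagram[OF assms(2)]] by auto
  have "i < m" "j < n"
    using ij assms(2) by (auto simp: diagrams_def box_def)
  with ij have "(m - 1 - i, n - 1 - j) \<notin> complement m n E"
    "complement m n D = insert (m - 1 - i, n - 1 - j) (complement m n E)"
    by (auto simp: complement_def box_def)
  then show ?thesis
    using covers_iff_insert[OF finite_diagram[OF complement_in_diagrams[OF assms(1)]]] by blast
qed

text \<open>Covers are reversed, which the undirected graph does not see.\<close>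

lemma complement_iso: "graph_iso (complement m n) (diagram_graph m n) (diagram_graph m n)"
proof -
  have "bij_betw (complement m n) (diagrams m n) (diagrams m n)"
    by (rule bij_betwI[where g = "complement m n"])
      (auto simp: complement_in_diagrams complement_complement)
  moreover have "covers (complement m n D) (complement m n E) \<longleftrightarrow> covers E D"
    if "D \<in> diagrams m n" "E \<in> diagrams m n" for D E
    using complement_covers[OF that] that complement_in_diagrams complement_complement
      complement_covers[of "complement m n E" m n "complement m n D"] by auto
  ultimately show ?thesis
    by (auto simp: graph_iso_def parcs_diagram_graph_iff complement_in_diagrams)
qed

section \<open>The automorphism groups\<close>

lemma row_column_in_diagrams:
  assumes "2 \<le> m" "2 \<le> n"
  shows "{(0, 0), (0, 1)} \<in> diagrams m n" "{(0, 0), (1, 0)} \<in> diagrams m n"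
  using assms by (auto simp: diagrams_def box_def)

text \<open>The two diagrams with two cells are permuted by \<open>f\<close>; the two possible
  permutations give the two alternatives.\<close>

lemma diagram_automorphism_fixing_empty:
  assumes f: "graph_iso f (diagram_graph m n) (diagram_graph m n)" "f {} = {}"
    and mn: "2 \<le> m" "2 \<le> n"
  shows "(\<forall>D \<in> diagrams m n. f D = D) \<or> (m = n \<and> (\<forall>D \<in> diagrams m n. f D = prod.swap ` D))"
proof -
  let ?R = "{(0, 0), (0, 1)} :: (nat \<times> nat) set" and ?C = "{(0, 0), (1, 0)} :: (nat \<times> nat) set"
  note RC = row_column_in_diagrams[OF mn]
  have f2: "f D = ?R \<or> f D = ?C" if "D \<in> diagrams m n" "card D = 2" for D
    using diagram_card_2[of "f D" m n] diagram_iso_card[OF f that(1)] that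
      graph_iso_in_verts[OF f(1)] by simp
  have "f ?R \<noteq> f ?C"
    using graph_iso_eq_iff[OF f(1), of ?R ?C] RC by auto
  moreover have "f ?R = ?R \<or> f ?R = ?C" "f ?C = ?R \<or> f ?C = ?C"
    by (rule f2[OF RC(1)], simp, rule f2[OF RC(2)], simp)
  ultimately consider "f ?R = ?R" "f ?C = ?C" | "f ?R = ?C" "f ?C = ?R"
    by metis
  then show ?thesis
  proof cases
    case 1
    then have "f D = D" if "D \<in> diagrams m n" "card D = 2" for D
      using diagram_card_2[OF that] by metis
    then show ?thesis
      using diagram_iso_fixes_all[OF f] by blast
  next
    case 2
    let ?g = "\<lambda>D. prod.swap ` f D"
    have g: "graph_iso ?g (diagram_graph m n) (diagram_graph n m)"
      using graph_iso_comp[OF f(1) swap_iso] .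
    have "prod.swap ` ?R = ?C" "prod.swap ` ?C = ?R"
      by auto
    then have "?g D = D" if "D \<in> diagrams m n" "card D = 2" for D
      using diagram_card_2[OF that] 2 by metis
    then have g_id: "?g D = D" if "D \<in> diagrams m n" for D
      using diagram_iso_fixes_all[OF g] f(2) that by simp
    \<comment> \<open>As \<open>?g\<close> fixes the full rectangle, it fits into the transposed
      one; its far corner gives both inequalities between \<open>m\<close> and
      \<open>n\<close>.\<close>
    have "box m n \<in> diagrams n m"
      using g_id[OF box_in_diagrams] graph_iso_in_verts[OF g, of "box m n"] box_in_diagrams by simp
    moreover have "(m - 1, n - 1) \<in> box m n"
      using mn by (simp add: box_def)
    ultimately have "(m - 1, n - 1) \<in> box n m"
      by (auto simp: diagrams_def)
    then have "m = n"
      using mn by (auto simp: box_def)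
    moreover have "f D = prod.swap ` D" if "D \<in> diagrams m n" for D
    proof -
      have "f D = prod.swap ` ?g D"
        by (simp add: image_comp)
      then show ?thesis
        using g_id[OF that] by simp
    qed
    ultimately show ?thesis
      by blast
  qed
qed

lemma diagram_automorphism_cases:
  assumes f: "graph_iso f (diagram_graph m n) (diagram_graph m n)" and mn: "2 \<le> m" "2 \<le> n"
  obtains c where "c = (\<lambda>D. D) \<or> c = complement m n"
    "(\<forall>D \<in> diagrams m n. f D = c D) \<or> (m = n \<and> (\<forall>D \<in> diagrams m n. f D = c (prod.swap ` D)))"
proof (cases "f {} = {}")
  case True
  show ?thesis
    by (rule that[OF disjI1[OF refl] diagram_automorphism_fixing_empty[OF f True mn]])
next
  case False
  \<comment> \<open>Here \<open>f {}\<close> is the full rectangle, so following \<open>f\<close> by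
    complementation fixes the empty diagram.\<close>
  then have "complement m n (f {}) = {}"
    using diagram_iso_empty[OF f] complement_complement[OF empty_in_diagrams]
    by (metis complement_empty)
  note * = diagram_automorphism_fixing_empty[OF graph_iso_comp[OF f complement_iso] this mn]
  have f_eq: "f D = complement m n E" if "D \<in> diagrams m n" "complement m n (f D) = E" for D E
    using complement_complement[of "f D" m n] graph_iso_in_verts[OF f] that by simp
  show ?thesis
    using *
  proof (elim disjE conjE)
    assume "\<forall>D \<in> diagrams m n. complement m n (f D) = D"
    then have "\<forall>D \<in> diagrams m n. f D = complement m n D"
      using f_eq by simp
    then show ?thesis
      by (intro that[OF disjI2[OF refl]] disjI1)
  next
    assume "m = n" "\<forall>D \<in> diagrams m n. complement m n (f D) = prod.swap ` D"
    then have "m = n \<and> (\<forall>D \<in> diagrams m n. f D = complement m n (prod.swap ` D))"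
      using f_eq by simp
    then show ?thesis
      by (intro that[OF disjI2[OF refl]] disjI2)
  qed
qed

text \<open>The case analysis bounds the group from above by complementation \<open>c\<close> and,
  for a square, transposition \<open>t\<close>. It remains to see that these are nontrivial and, for
  a square, distinct involutions.\<close>

lemma graph_Aut_diagram_graph:
  assumes mn: "2 \<le> m" "2 \<le> n"
  shows "m \<noteq> n \<Longrightarrow> graph_Aut (diagram_graph m n) \<cong> integer_mod_group 2"
    and "m = n \<Longrightarrow> graph_Aut (diagram_graph m n) \<cong> integer_mod_group 2 \<times>\<times> integer_mod_group 2"
proof -
  let ?G = "diagram_graph m n" and ?V = "diagrams m n"
  interpret group "graph_Aut ?G"
    by (rule group_graph_Aut)
  define c where "c = restrict (complement m n) ?V"
  have c: "c \<in> graph_automorphisms ?G"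
    using restrict_in_graph_automorphisms[OF complement_iso] by (simp add: c_def)
  have one: "\<one>\<^bsub>graph_Aut ?G\<^esub> = (\<lambda>D \<in> ?V. D)"
    by (simp add: graph_Aut_one)
  have ext: "f = restrict g ?V" if "f \<in> graph_automorphisms ?G" "\<forall>D \<in> ?V. f D = g D" for f g
    using that by (intro extensionalityI[of _ ?V]) (auto simp: graph_automorphisms_iff)
  have box_ne: "box m n \<noteq> {}"
    using mn by (auto simp: box_def lessThan_empty_iff)
  have c_empty: "c {} = box m n"
    by (simp add: c_def empty_in_diagrams complement_empty)
  then have c_ne: "c \<noteq> \<one>\<^bsub>graph_Aut ?G\<^esub>"
    using box_ne empty_in_diagrams[of m n] unfolding one by (metis restrict_apply')
  have aut_cases: "f = \<one>\<^bsub>graph_Aut ?G\<^esub> \<or> f = c \<or> m = n \<and>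
      (f = restrict ((`) prod.swap) ?V \<or> f = (\<lambda>D \<in> ?V. complement m n (prod.swap ` D)))"
    if f: "f \<in> graph_automorphisms ?G" for f
  proof -
    have "graph_iso f ?G ?G"
      using f by (simp add: graph_automorphisms_iff)
    then obtain e where e: "e = (\<lambda>D. D) \<or> e = complement m n"
      "(\<forall>D \<in> ?V. f D = e D) \<or> (m = n \<and> (\<forall>D \<in> ?V. f D = e (prod.swap ` D)))"
      using diagram_automorphism_cases[OF _ mn] by metis
    from e(2) have "f = restrict e ?V \<or> m = n \<and> f = (\<lambda>D \<in> ?V. e (prod.swap ` D))"
      using ext[OF f, of e] ext[OF f, of "\<lambda>D. e (prod.swap ` D)"] by argo
    with e(1) show ?thesis
      unfolding one c_def by (elim disjE) simp_all
  qed
  {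
    assume "m \<noteq> n"
    then have "carrier (graph_Aut ?G) = {\<one>\<^bsub>graph_Aut ?G\<^esub>, c}"
      using c one_closed aut_cases unfolding graph_Aut_carrier by blast
    then show "graph_Aut ?G \<cong> integer_mod_group 2"
      using is_iso_two_elements c_ne by blast
  }
  assume "m = n"
  define t where "t = restrict ((`) prod.swap) ?V"
  have swap: "prod.swap ` D \<in> ?V" if "D \<in> ?V" for D
    using swap_in_diagrams that \<open>m = n\<close> by blast
  have t: "t \<in> graph_automorphisms ?G"
    using restrict_in_graph_automorphisms[of "(`) prod.swap" ?G] swap_iso[of m n] \<open>m = n\<close>
    by (simp add: t_def)
  have ct: "c \<otimes>\<^bsub>graph_Aut ?G\<^esub> t = (\<lambda>D \<in> ?V. complement m n (prod.swap ` D))"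
    unfolding graph_Aut_mult[OF c t] by (auto simp: c_def t_def swap intro!: restrict_ext)
  have cc: "c \<otimes>\<^bsub>graph_Aut ?G\<^esub> c = \<one>\<^bsub>graph_Aut ?G\<^esub>"
    unfolding graph_Aut_mult[OF c c] one
    by (auto simp: c_def complement_in_diagrams complement_complement intro!: restrict_ext)
  have tt: "t \<otimes>\<^bsub>graph_Aut ?G\<^esub> t = \<one>\<^bsub>graph_Aut ?G\<^esub>"
    unfolding graph_Aut_mult[OF t t] one
    by (auto simp: t_def swap image_comp intro!: restrict_ext)
  \<comment> \<open>The empty diagram separates \<open>t\<close> from \<open>c\<close>, and the row
    of two cells separates \<open>t\<close> from the identity.\<close>
  have "t {} = {}" "t {(0, 0), (0, 1)} = {(0, 0), (1, 0)}"
    using row_column_in_diagrams[OF mn] by (auto simp: t_def empty_in_diagrams)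
  then have t_ne: "t \<noteq> \<one>\<^bsub>graph_Aut ?G\<^esub>" "c \<noteq> t"
    using row_column_in_diagrams[OF mn] c_empty box_ne by (auto simp: one doubleton_eq_iff)
  have "f \<in> {\<one>\<^bsub>graph_Aut ?G\<^esub>, c, t, c \<otimes>\<^bsub>graph_Aut ?G\<^esub> t}"
    if f: "f \<in> graph_automorphisms ?G" for f
    using aut_cases[OF f] unfolding t_def[symmetric] ct[symmetric] by blast
  moreover have "c \<otimes>\<^bsub>graph_Aut ?G\<^esub> t \<in> graph_automorphisms ?G"
    using m_closed[of c t] c t by (simp only: graph_Aut_carrier)
  ultimately have "carrier (graph_Aut ?G) =
      {\<one>\<^bsub>graph_Aut ?G\<^esub>, c, t, c \<otimes>\<^bsub>graph_Aut ?G\<^esub> t}"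
    using c t one_closed unfolding graph_Aut_carrier by blast
  then show "graph_Aut ?G \<cong> integer_mod_group 2 \<times>\<times> integer_mod_group 2"
    using is_iso_Klein_four cc tt c_ne t_ne by blast
qed

section \<open>Young diagrams: from weak partitions to order ideals\<close>

definition young_diagram :: "nat list \<Rightarrow> (nat \<times> nat) set" where
  "young_diagram xs = {(i, j). i < length xs \<and> j < xs ! i}"

lemma pverts_Pi_graph_iff:
  "xs \<in> pverts (Pi_graph p q) \<longleftrightarrow>
    length xs = q \<and> sorted_wrt (\<ge>) xs \<and> (\<forall>i < q. xs ! i \<le> p)"
  by (auto simp: Pi_graph_def Let_def all_set_conv_all_nth)

lemma parcs_Pi_graph_iff:
  "(xs, ys) \<in> parcs (Pi_graph p q) \<longleftrightarrow> xs \<in> pverts (Pi_graph p q) \<and>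
    ys \<in> pverts (Pi_graph p q) \<and> (add_one_to_part xs ys \<or> add_one_to_part ys xs)"
  by (auto simp: Pi_graph_def Let_def)

lemma finite_young_diagram: "finite (young_diagram xs)"
proof -
  have "young_diagram xs = (SIGMA i:{..<length xs}. {..<xs ! i})"
    by (auto simp: young_diagram_def)
  then show ?thesis
    by simp
qed

text \<open>The lengths must agree because parts equal to 0 contribute no cells.\<close>

lemma young_diagram_inj:
  assumes "length xs = length ys" "young_diagram xs = young_diagram ys"
  shows "xs = ys"
proof (rule nth_equalityI[OF assms(1)])
  fix i assume "i < length xs"
  then have "j < xs ! i \<longleftrightarrow> j < ys ! i" for j
    using assms by (auto simp: young_diagram_def set_eq_iff)
  then show "xs ! i = ys ! i"
    by (meson linorder_neqE_nat less_irrefl)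
qed

lemma young_diagram_add_one:
  assumes "i < length xs"
  shows "young_diagram (xs[i := xs ! i + 1]) = insert (i, xs ! i) (young_diagram xs)"
  using assms by (auto simp: young_diagram_def nth_list_update split: if_splits)

lemma young_diagram_covers_iff:
  assumes len: "length xs = length ys"
  shows "covers (young_diagram ys) (young_diagram xs) \<longleftrightarrow> add_one_to_part xs ys"
proof
  assume "covers (young_diagram ys) (young_diagram xs)"
  then obtain i j where ij: "(i, j) \<notin> young_diagram xs"
    "young_diagram ys = insert (i, j) (young_diagram xs)"
    using covers_iff_insert[OF finite_young_diagram] by auto
  have "(i, j) \<in> young_diagram ys"
    using ij(2) by blast
  then have i: "i < length xs" "xs ! i \<le> j" "j < ys ! i"
    using ij(1) len by (auto simp: young_diagram_def)
  \<comment> \<open>The first free cell of row \<open>i\<close> is also new, and only one cell is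
    new, so it is \<open>(i, j)\<close>.\<close>
  then have "(i, xs ! i) \<in> young_diagram ys"
    using len by (simp add: young_diagram_def)
  moreover have "(i, xs ! i) \<notin> young_diagram xs"
    by (simp add: young_diagram_def)
  ultimately have "j = xs ! i"
    unfolding ij(2) by simp
  then have "young_diagram ys = young_diagram (xs[i := xs ! i + 1])"
    using ij(2) young_diagram_add_one[OF i(1)] by simp
  then have "ys = xs[i := xs ! i + 1]"
    using young_diagram_inj[of ys "xs[i := xs ! i + 1]"] len by simp
  then show "add_one_to_part xs ys"
    using i(1) by (auto simp: add_one_to_part_def)
next
  assume "add_one_to_part xs ys"
  then obtain i where i: "i < length xs" "ys = xs[i := xs ! i + 1]"
    by (auto simp: add_one_to_part_def)
  moreover have "(i, xs ! i) \<notin> young_diagram xs"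
    by (simp add: young_diagram_def)
  ultimately show "covers (young_diagram ys) (young_diagram xs)"
    using young_diagram_add_one[OF i(1)] covers_iff_insert[OF finite_young_diagram] by blast
qed

lemma young_diagram_in_diagrams:
  assumes "xs \<in> pverts (Pi_graph p q)"
  shows "young_diagram xs \<in> diagrams q p"
proof -
  have len: "length xs = q" and p: "\<And>i. i < q \<Longrightarrow> xs ! i \<le> p"
    and sorted: "\<And>i k. k \<le> i \<Longrightarrow> i < q \<Longrightarrow> xs ! i \<le> xs ! k"
    using assms by (auto simp: pverts_Pi_graph_iff sorted_wrt_iff_nth_less le_less)
  have "(k, l) \<in> young_diagram xs" if "(i, j) \<in> young_diagram xs" "k \<le> i" "l \<le> j" for i j k l
    using that sorted[of k i] len by (auto simp: young_diagram_def)
  moreover have "(i, j) \<in> box q p" if "(i, j) \<in> young_diagram xs" for i j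
    using that p[of i] len by (auto simp: young_diagram_def box_def)
  ultimately show ?thesis
    by (auto simp: diagrams_def)
qed

lemma diagram_eq_young_diagram:
  assumes D: "D \<in> diagrams q p"
  shows "D \<in> young_diagram ` pverts (Pi_graph p q)"
proof -
  \<comment> \<open>\<open>r i\<close> is the length of row \<open>i\<close>. The cell
    \<open>(i, p)\<close> lies outside the box, so the minimum exists and is at most
    \<open>p\<close>.\<close>
  define r where "r i = (LEAST j. (i, j) \<notin> D)" for i
  have notin: "(i, p) \<notin> D" for i
    using D by (auto simp: diagrams_def box_def)
  have r: "(i, j) \<in> D \<longleftrightarrow> j < r i" for i j
  proof
    assume "(i, j) \<in> D"
    moreover have "(i, r i) \<notin> D"
      unfolding r_def by (rule LeastI[of "\<lambda>j. (i, j) \<notin> D", OF notin])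
    ultimately show "j < r i"
      using diagram_down[OF D, of "(i, j)" "(i, r i)"] by (auto simp: not_less[symmetric])
  qed (use not_less_Least in \<open>auto simp: r_def\<close>)
  have "r i \<le> p" for i
    using r[of i p] notin by (simp add: not_less)
  moreover have "r i \<le> r k" if "k < i" for i k
  proof (rule ccontr)
    assume "\<not> r i \<le> r k"
    then have "(i, r k) \<in> D"
      using r by simp
    then have "(k, r k) \<in> D"
      using diagram_down[OF D, of "(i, r k)" "(k, r k)"] that by simp
    then show False
      using r by simp
  qed
  ultimately have "map r [0..<q] \<in> pverts (Pi_graph p q)"
    by (simp add: pverts_Pi_graph_iff sorted_wrt_iff_nth_less)
  moreover have "i < q" if "(i, j) \<in> D" for i j
    using D that by (auto simp: diagrams_def box_def)
  then have "D = young_diagram (map r [0..<q])"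
    by (auto simp: young_diagram_def r)
  ultimately show ?thesis
    by blast
qed

text \<open>The parameters change places because the \<open>q\<close> parts are the rows and
  \<open>p\<close> bounds their lengths.\<close>

lemma young_diagram_iso: "graph_iso young_diagram (Pi_graph p q) (diagram_graph q p)"
proof -
  have len: "length xs = q" if "xs \<in> pverts (Pi_graph p q)" for xs
    using that by (simp add: pverts_Pi_graph_iff)
  have "bij_betw young_diagram (pverts (Pi_graph p q)) (diagrams q p)"
    unfolding bij_betw_def
  proof (intro conjI inj_onI equalityI subsetI)
    fix xs ys assume "xs \<in> pverts (Pi_graph p q)" "ys \<in> pverts (Pi_graph p q)"
      "young_diagram xs = young_diagram ys"
    then show "xs = ys"
      using young_diagram_inj len by metis
  qed (auto intro: young_diagram_in_diagrams diagram_eq_young_diagram)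
  then show ?thesis
    by (auto simp: graph_iso_def parcs_diagram_graph_iff parcs_Pi_graph_iff
        young_diagram_in_diagrams young_diagram_covers_iff len)
qed

theorem theorem6p6:
  fixes p q :: nat
  assumes "min p q \<ge> 2"
  shows "(p \<noteq> q \<longrightarrow> graph_Aut (Pi_graph p q) \<cong> integer_mod_group 2) \<and>
         (p = q \<longrightarrow> graph_Aut (Pi_graph p q) \<cong> integer_mod_group 2 \<times>\<times> integer_mod_group 2)"
proof -
  have "graph_Aut (Pi_graph p q) \<cong> graph_Aut (diagram_graph q p)"
    by (rule graph_Aut_cong[OF young_diagram_iso])
  moreover have "2 \<le> q" "2 \<le> p"
    using assms by auto
  ultimately show ?thesis
    using graph_Aut_diagram_graph iso_trans by metis
qed

end
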